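(* There exists a finite connected simple graph $G$ with at least one edge such that $\Pr_x(Z(n)=x)=\Pr_y(Z(n)=y)$ for every $n\in\mathbb{N}$ and all $x,y\in V(G)$, but $G$ is not vertex-transitive.
   Context: Graphs are undirected. Here $(Z(n))_{n\ge 0}$ denotes simple random walk on $G$ (at each step the walk moves to a neighbour of the current vertex chosen uniformly at random), and $\Pr_x(Z(n)=x)$ denotes the probability that simple random walk started at $x$ is at its starting vertex $x$ after $n$ steps. A graph is vertex-transitive if its automorphism group acts transitively on its vertex set. *)

theory Defs
  imports "HOL-Probability.Probability" "Graph_Theory.Graph_Theory"
begin

definition neighbours :: "'a pair_pre_digraph \<Rightarrow> 'a \<Rightarrow> 'a set" where
  "neighbours G u = {v. u \<rightarrow>\<^bsub>with_proj G\<^esub> v}"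

(* Meaningful when u has a neighbour and the graph is locally finite; pmf_of_set is unspecified
   on empty and on infinite sets. *)
definition srw_step :: "'a pair_pre_digraph \<Rightarrow> 'a \<Rightarrow> 'a pmf" where
  "srw_step G u = pmf_of_set (neighbours G u)"

(* The law of the position Z(n) of simple random walk started at x. *)
primrec srw :: "'a pair_pre_digraph \<Rightarrow> 'a \<Rightarrow> nat \<Rightarrow> 'a pmf" where
  "srw G x 0 = return_pmf x"
| "srw G x (Suc n) = bind_pmf (srw G x n) (srw_step G)"

definition return_prob :: "'a pair_pre_digraph \<Rightarrow> 'a \<Rightarrow> nat \<Rightarrow> real" where
  "return_prob G x n = measure_pmf.prob (srw G x n) {x}"

definition graph_automorphism ::
    "'a pair_pre_digraph \<Rightarrow> ('a, 'a \<times> 'a, 'a, 'a \<times> 'a) digraph_isomorphism \<Rightarrow> bool" where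
  "graph_automorphism G \<phi> \<longleftrightarrow>
     pre_digraph.digraph_isomorphism (with_proj G) \<phi> \<and> app_iso \<phi> (with_proj G) = with_proj G"

definition vertex_transitive :: "'a pair_pre_digraph \<Rightarrow> bool" where
  "vertex_transitive G \<longleftrightarrow>
     (\<forall>x\<in>pverts G. \<forall>y\<in>pverts G. \<exists>\<phi>. graph_automorphism G \<phi> \<and> iso_verts \<phi> x = y)"

end

(* The witness is a 4-regular graph on 12 vertices whose adjacency matrix A satisfies
   A^3 = 4 A + 4 J, with J the all-ones matrix. Dividing by 64, the probability p n of being at
   the starting vertex satisfies p (n + 3) = p (n + 1) / 4 + 1 / 16, whatever that vertex is. As
   also p 0 = 1, p 1 = 0 and p 2 = 1/4 everywhere, the return probabilities do not depend on the
   starting vertex. On the other hand every edge at vertex 8 lies in a triangle while the edge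
   joining 0 and 2 does not, so no automorphism maps 8 to 0. *)
theory Submission
  imports Defs
begin

lemma neighbours_iff: "v \<in> neighbours G u \<longleftrightarrow> (u, v) \<in> parcs G"
  by (simp add: neighbours_def arcs_ends_def arc_to_ends_def)

text \<open>An isomorphism record carries separate maps for arcs, tails and heads. Fixing
  \<open>with_proj G\<close> forces its tail and head maps to be \<open>fst\<close> and
  \<open>snd\<close>, so on arcs the vertex map determines everything.\<close>

lemma neighbours_graph_automorphism:
  assumes aut: "graph_automorphism G \<phi>" and u: "u \<in> pverts G"
  shows "neighbours G (iso_verts \<phi> u) = iso_verts \<phi> ` neighbours G u"
proof -
  from aut have iso: "pre_digraph.digraph_isomorphism (with_proj G) \<phi>"
    and app: "app_iso \<phi> (with_proj G) = with_proj G"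
    by (auto simp: graph_automorphism_def)
  have arcs: "iso_arcs \<phi> ` parcs G = parcs G"
    using arg_cong[OF app, of arcs] by simp
  have tail: "iso_tail \<phi> = fst" and head: "iso_head \<phi> = snd"
    using arg_cong[OF app, of tail] arg_cong[OF app, of head] by simp_all
  have arc: "iso_arcs \<phi> (a, b) = (iso_verts \<phi> a, iso_verts \<phi> b)" if "(a, b) \<in> parcs G" for a b
    using iso that unfolding pre_digraph.digraph_isomorphism_def tail head
    by (auto simp: prod_eq_iff)
  have wf: "wf_digraph (with_proj G)" and inj: "inj_on (iso_verts \<phi>) (pverts G)"
    using iso unfolding pre_digraph.digraph_isomorphism_def by auto
  show ?thesis
  proof (intro set_eqI iffI)
    fix v assume "v \<in> neighbours G (iso_verts \<phi> u)"
    then have "(iso_verts \<phi> u, v) \<in> iso_arcs \<phi> ` parcs G"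
      using arcs by (simp add: neighbours_iff)
    then obtain a b where "(a, b) \<in> parcs G" "(iso_verts \<phi> u, v) = iso_arcs \<phi> (a, b)"
      by auto
    \<comment> \<open>Injectivity is known only on \<open>pverts G\<close>, so \<open>a\<close> must
      be a vertex before it can be identified with \<open>u\<close>.\<close>
    moreover from this have "a \<in> pverts G"
      using wf_digraph.tail_in_verts[OF wf, of "(a, b)"] by simp
    ultimately show "v \<in> iso_verts \<phi> ` neighbours G u"
      using arc u inj by (auto simp: neighbours_iff inj_on_def)
  next
    fix v assume "v \<in> iso_verts \<phi> ` neighbours G u"
    then obtain b where b: "(u, b) \<in> parcs G" "v = iso_verts \<phi> b"
      by (auto simp: neighbours_iff)
    then have "iso_arcs \<phi> (u, b) \<in> parcs G" using arcs by blast
    then show "v \<in> neighbours G (iso_verts \<phi> u)"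
      using arc b by (simp add: neighbours_iff)
  qed
qed

text \<open>Each step is uniform on a finite nonempty set of vertices, so the walk cannot leave the
  graph. This turns expectations over the walk into finite sums.\<close>

lemma set_pmf_srw_subset:
  assumes "pair_fin_digraph G" "x \<in> pverts G"
    and "\<And>u. u \<in> pverts G \<Longrightarrow> neighbours G u \<noteq> {}"
  shows "set_pmf (srw G x n) \<subseteq> pverts G"
proof -
  interpret pair_fin_digraph G by fact
  have sub: "neighbours G u \<subseteq> pverts G" for u
    using in_arcsD2 by (auto simp: neighbours_iff)
  show ?thesis
  proof (induction n)
    case (Suc n)
    have "set_pmf (srw_step G u) \<subseteq> pverts G" if "u \<in> pverts G" for u
      using assms(3)[OF that] sub[of u] finite_subset[OF sub[of u] pair_finite_verts]
      by (simp add: srw_step_def)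
    then show ?case using Suc.IH by auto
  qed (use assms in auto)
qed

text \<open>In a regular undirected graph the transition matrix is symmetric, so summing over the
  predecessors of \<open>y\<close> is averaging over its neighbours. For \<open>y\<close> outside
  the graph both sides vanish.\<close>

lemma pmf_srw_Suc:
  assumes "pair_graph G" "x \<in> pverts G"
    and card: "\<And>u. u \<in> pverts G \<Longrightarrow> card (neighbours G u) = d" and "d > 0"
  shows "pmf (srw G x (Suc n)) y = (\<Sum>z\<in>neighbours G y. pmf (srw G x n) z) / d"
proof -
  interpret pair_graph G by fact
  have sub: "neighbours G u \<subseteq> pverts G" for u
    using in_arcsD2 by (auto simp: neighbours_iff)
  have fin: "finite (neighbours G u)" for u
    using finite_subset[OF sub pair_finite_verts] .
  have ne: "neighbours G u \<noteq> {}" if "u \<in> pverts G" for u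
    using card[OF that] \<open>d > 0\<close> by auto
  have symm: "y \<in> neighbours G z \<longleftrightarrow> z \<in> neighbours G y" for z
    using pair_sym_arcs by (auto simp: neighbours_iff symmetric_def elim: symE)
  have supp: "set_pmf (srw G x n) \<subseteq> pverts G"
    using assms(2) ne by (intro set_pmf_srw_subset) unfold_locales
  have "pmf (srw G x (Suc n)) y
      = (\<Sum>z\<in>pverts G. pmf (srw G x n) z * pmf (srw_step G z) y)"
    using supp by (simp add: pmf_bind integral_measure_pmf[OF pair_finite_verts] subset_iff)
  also have "\<dots> = (\<Sum>z\<in>pverts G. if z \<in> neighbours G y then pmf (srw G x n) z / d else 0)"
    using ne card fin symm
    by (intro sum.cong) (auto simp: srw_step_def pmf_of_set indicator_def)
  also have "\<dots> = (\<Sum>z\<in>neighbours G y. pmf (srw G x n) z / d)"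
    using sub[of y] by (simp add: sum.If_cases Int_absorb1)
  finally show ?thesis by (simp add: sum_divide_distrib)
qed

text \<open>Entry \<open>u\<close> lists the neighbours of \<open>u\<close>. Vertices 0 to 7 form
  the 4-cycles 0-2-6-4 and 1-3-7-5. Vertices 8 to 11 are independent, each joined to both ends of
  two cyclically consecutive edges among 0-4, 1-5, 2-6, 3-7.\<close>

definition adjacency_lists :: "nat list list" where
  "adjacency_lists =
    [[2, 4, 8, 9], [3, 5, 9, 10], [0, 6, 10, 11], [1, 7, 8, 11],
     [0, 6, 8, 9], [1, 7, 9, 10], [2, 4, 10, 11], [3, 5, 8, 11],
     [0, 3, 4, 7], [0, 1, 4, 5], [1, 2, 5, 6], [2, 3, 6, 7]]"

definition G12 :: "nat pair_pre_digraph" where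
  "G12 = \<lparr>pverts = {..<12}, parcs = {(u, v). u < 12 \<and> v \<in> set (adjacency_lists ! u)}\<rparr>"

lemma pverts_G12: "pverts G12 = {0, 1, 2, 3, 4, 5, 6, 7, 8, 9, 10, 11}"
  by (simp add: G12_def set_eq_iff) presburger

text \<open>Vertex 1 appears as \<open>Suc 0\<close> on the left because the simplifier normalises
  it to that form.\<close>

lemma neighbours_G12:
  "neighbours G12 0 = {2, 4, 8, 9}" "neighbours G12 (Suc 0) = {3, 5, 9, 10}"
  "neighbours G12 2 = {0, 6, 10, 11}" "neighbours G12 3 = {1, 7, 8, 11}"
  "neighbours G12 4 = {0, 6, 8, 9}" "neighbours G12 5 = {1, 7, 9, 10}"
  "neighbours G12 6 = {2, 4, 10, 11}" "neighbours G12 7 = {3, 5, 8, 11}"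
  "neighbours G12 8 = {0, 3, 4, 7}" "neighbours G12 9 = {0, 1, 4, 5}"
  "neighbours G12 10 = {1, 2, 5, 6}" "neighbours G12 11 = {2, 3, 6, 7}"
  by (auto simp: set_eq_iff neighbours_iff G12_def adjacency_lists_def)

lemma parcs_G12: "parcs G12 = (SIGMA u:pverts G12. neighbours G12 u)"
  by (auto simp: neighbours_iff G12_def)

lemma pair_graph_G12: "pair_graph G12"
proof
  show "finite (pverts G12)" by (simp add: G12_def)
  show "finite (parcs G12)"
    unfolding parcs_G12 by (rule finite_SigmaI) (auto simp: pverts_G12 neighbours_G12)
  show "symmetric (with_proj G12)"
    unfolding symmetric_def
    by (rule symI) (auto simp: arcs_ends_def arc_to_ends_def parcs_G12 pverts_G12 neighbours_G12)
qed (auto simp: parcs_G12 pverts_G12 neighbours_G12)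

lemma card_neighbours_G12: "u \<in> pverts G12 \<Longrightarrow> card (neighbours G12 u) = 4"
  by (auto simp: pverts_G12 neighbours_G12)

lemma neighbours_G12_nonempty: "u \<in> pverts G12 \<Longrightarrow> neighbours G12 u \<noteq> {}"
  using card_neighbours_G12[of u] by auto

lemma connected_G12: "Digraph_Component.connected (with_proj G12)"
proof -
  interpret pair_graph G12 by (rule pair_graph_G12)
  have step: "u \<rightarrow>\<^sup>*\<^bsub>with_proj G12\<^esub> w"
    if "v \<in> pverts G12" "w \<in> neighbours G12 v" "u \<rightarrow>\<^sup>*\<^bsub>with_proj G12\<^esub> v" for u v w
    using that reachable_adj_trans by (auto simp: neighbours_def)
  have r0: "0 \<rightarrow>\<^sup>*\<^bsub>with_proj G12\<^esub> 0" by (simp add: pverts_G12)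
  have r1: "0 \<rightarrow>\<^sup>*\<^bsub>with_proj G12\<^esub> w" if "w \<in> {2, 4, 8, 9}" for w
    using step[OF _ _ r0, of w] that by (simp add: pverts_G12 neighbours_G12)
  \<comment> \<open>The neighbours 2, 8 and 9 of vertex 0 suffice to reach all vertices at distance
    two.\<close>
  have r2: "0 \<rightarrow>\<^sup>*\<^bsub>with_proj G12\<^esub> w" if "w \<in> {1, 3, 5, 6, 7, 10, 11}" for w
    using that step[OF _ _ r1, of 2 w] step[OF _ _ r1, of 8 w] step[OF _ _ r1, of 9 w]
    by (auto simp: pverts_G12 neighbours_G12)
  have "0 \<rightarrow>\<^sup>*\<^bsub>with_proj G12\<^esub> w" if "w \<in> pverts G12" for w
    using that r0 r1[of w] r2[of w] unfolding pverts_G12 by blast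
  then have "u \<rightarrow>\<^sup>*\<^bsub>with_proj G12\<^esub> w" if "u \<in> pverts G12" "w \<in> pverts G12" for u w
    using that symmetric_reachable[OF sym_arcs] reachable_trans by blast
  moreover have "pverts G12 \<noteq> {}" by (simp add: pverts_G12)
  ultimately show ?thesis
    by (simp add: connected_def strongly_connected_def reachable_mk_symmetric_eq[OF pair_sym_arcs])
qed

lemma sum_neighbours_G12:
  fixes f :: "nat \<Rightarrow> real"
  shows
    "sum f (neighbours G12 0) = f 2 + f 4 + f 8 + f 9"
    "sum f (neighbours G12 (Suc 0)) = f 3 + f 5 + f 9 + f 10"
    "sum f (neighbours G12 2) = f 0 + f 6 + f 10 + f 11"
    "sum f (neighbours G12 3) = f (Suc 0) + f 7 + f 8 + f 11"
    "sum f (neighbours G12 4) = f 0 + f 6 + f 8 + f 9"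
    "sum f (neighbours G12 5) = f (Suc 0) + f 7 + f 9 + f 10"
    "sum f (neighbours G12 6) = f 2 + f 4 + f 10 + f 11"
    "sum f (neighbours G12 7) = f 3 + f 5 + f 8 + f 11"
    "sum f (neighbours G12 8) = f 0 + f 3 + f 4 + f 7"
    "sum f (neighbours G12 9) = f 0 + f (Suc 0) + f 4 + f 5"
    "sum f (neighbours G12 10) = f (Suc 0) + f 2 + f 5 + f 6"
    "sum f (neighbours G12 11) = f 2 + f 3 + f 6 + f 7"
  by (simp_all add: neighbours_G12)

text \<open>This is row \<open>y\<close> of A^3 = 4 A + 4 J applied to \<open>f\<close>: there are 8
  walks of length 3 from \<open>y\<close> to each neighbour and 4 to every other vertex,
  \<open>y\<close> included. Each row is checked as a linear identity in the twelve values of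
  \<open>f\<close>.\<close>

lemma cube_adjacency_G12:
  fixes f :: "nat \<Rightarrow> real"
  assumes "y \<in> pverts G12"
  shows "(\<Sum>a\<in>neighbours G12 y. \<Sum>b\<in>neighbours G12 a. sum f (neighbours G12 b))
    = 4 * sum f (neighbours G12 y) + 4 * sum f (pverts G12)"
proof -
  have total: "sum f (pverts G12) = f 0 + f (Suc 0) + f 2 + f 3 + f 4 + f 5 + f 6 + f 7
      + f 8 + f 9 + f 10 + f 11"
    by (simp add: pverts_G12)
  have "y \<in> {0, Suc 0, 2, 3, 4, 5, 6, 7, 8, 9, 10, 11}"
    using assms by (simp add: pverts_G12)
  then show ?thesis
    unfolding total by (elim insertE emptyE) (simp_all add: sum_neighbours_G12 algebra_simps)
qed

lemma pmf_srw_G12_Suc: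
  assumes "x \<in> pverts G12"
  shows "pmf (srw G12 x (Suc n)) y = (\<Sum>z\<in>neighbours G12 y. pmf (srw G12 x n) z) / 4"
  using pmf_srw_Suc[OF pair_graph_G12 assms card_neighbours_G12] by simp

lemma pmf_srw_G12_recurrence:
  assumes "x \<in> pverts G12" "y \<in> pverts G12"
  shows "pmf (srw G12 x (n + 3)) y = pmf (srw G12 x (n + 1)) y / 4 + 1 / 16"
proof -
  interpret pair_graph G12 by (rule pair_graph_G12)
  \<comment> \<open>The J term of the cubic identity sees only the total mass.\<close>
  have total: "sum (pmf (srw G12 x n)) (pverts G12) = 1"
    using assms(1) neighbours_G12_nonempty
    by (intro sum_pmf_eq_1 set_pmf_srw_subset pair_finite_verts) unfold_locales
  have "pmf (srw G12 x (n + 3)) y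
      = (\<Sum>a\<in>neighbours G12 y. \<Sum>b\<in>neighbours G12 a.
          sum (pmf (srw G12 x n)) (neighbours G12 b)) / 64"
    by (simp only: numeral_3_eq_3 add_Suc_right add_0_right pmf_srw_G12_Suc[OF assms(1)]
        sum_divide_distrib[symmetric])
  also have "\<dots> = (\<Sum>z\<in>neighbours G12 y. pmf (srw G12 x n) z) / 16 + 1 / 16"
    unfolding cube_adjacency_G12[OF assms(2)] total by simp
  \<comment> \<open>One quarter of the factor 1/16 turns the neighbour sum into the probability at
    time \<open>n + 1\<close>; the other quarter is the coefficient.\<close>
  finally show ?thesis
    by (simp add: pmf_srw_G12_Suc[OF assms(1)] del: srw.simps)
qed

lemma return_prob_G12:
  assumes x: "x \<in> pverts G12" and y: "y \<in> pverts G12"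
  shows "return_prob G12 x n = return_prob G12 y n"
proof -
  \<comment> \<open>The recurrence first applies at time 3, so earlier times are computed directly.
    There are no loops, and 4 of the 16 walks of length 2 from \<open>z\<close> return to
    \<open>z\<close>.\<close>
  have init: "pmf (srw G12 z 1) z = 0" "pmf (srw G12 z 2) z = 1 / 4" if "z \<in> pverts G12" for z
  proof -
    have "z \<in> {0, Suc 0, 2, 3, 4, 5, 6, 7, 8, 9, 10, 11}"
      using that by (simp add: pverts_G12)
    then have "(\<Sum>a\<in>neighbours G12 z. pmf (return_pmf z) a) = 0"
      "(\<Sum>a\<in>neighbours G12 z. \<Sum>b\<in>neighbours G12 a. pmf (return_pmf z) b) = 4"
      by (elim insertE emptyE; simp add: sum_neighbours_G12)+
    then show "pmf (srw G12 z 1) z = 0" "pmf (srw G12 z 2) z = 1 / 4"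
      by (simp_all add: numeral_2_eq_2 pmf_srw_G12_Suc[OF that]
          sum_divide_distrib[symmetric] del: srw.simps(2))
  qed
  have "pmf (srw G12 x n) x = pmf (srw G12 y n) y"
  proof (induction n rule: less_induct)
    case (less n)
    have "n < 3 \<longrightarrow> n = 0 \<or> n = 1 \<or> n = 2" by arith
    then consider "n = 0" | "n = 1" | "n = 2" | m where "n = m + 3"
      using le_Suc_ex[of 3 n] by (metis add.commute not_less)
    then show ?case
    proof cases
      case 4
      then have "pmf (srw G12 x (m + 1)) x = pmf (srw G12 y (m + 1)) y"
        by (intro less.IH) simp
      then show ?thesis
        unfolding 4 pmf_srw_G12_recurrence[OF x x] pmf_srw_G12_recurrence[OF y y] by (rule arg_cong)
    qed (simp_all only: init[OF x] init[OF y] srw.simps(1) pmf_return indicator_simps singletonI)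
  qed
  then show ?thesis by (simp add: return_prob_def measure_pmf_single)
qed

lemma not_vertex_transitive_G12: "\<not> vertex_transitive G12"
proof
  assume "vertex_transitive G12"
  have "8 \<in> pverts G12" "0 \<in> pverts G12" by (simp_all add: pverts_G12)
  with \<open>vertex_transitive G12\<close> obtain \<phi> where \<phi>: "graph_automorphism G12 \<phi>" "iso_verts \<phi> 8 = 0"
    unfolding vertex_transitive_def by blast
  note image = neighbours_graph_automorphism[OF \<phi>(1), symmetric]
  have image_8: "iso_verts \<phi> ` neighbours G12 8 = neighbours G12 0"
    using image[OF \<open>8 \<in> pverts G12\<close>] \<phi>(2) by simp
  then have "2 \<in> iso_verts \<phi> ` neighbours G12 8" by (simp add: neighbours_G12)
  then obtain w where w: "w \<in> neighbours G12 8" "iso_verts \<phi> w = 2" by auto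
  \<comment> \<open>The neighbours of 8 split into the adjacent pairs 0, 4 and 3, 7, so every edge
    at 8 closes up to a triangle.\<close>
  then have "neighbours G12 8 \<inter> neighbours G12 w \<noteq> {}" and "w \<in> pverts G12"
    by (auto simp: neighbours_G12 pverts_G12)
  then obtain u where u: "u \<in> neighbours G12 8" "u \<in> neighbours G12 w" by blast
  have "iso_verts \<phi> ` neighbours G12 w = neighbours G12 2"
    using image[OF \<open>w \<in> pverts G12\<close>] w(2) by simp
  \<comment> \<open>The triangle on 8, \<open>w\<close> and \<open>u\<close> would be carried to one
    on the edge joining 0 and 2, whose ends have disjoint neighbourhoods.\<close>
  with u image_8 have "iso_verts \<phi> u \<in> neighbours G12 0 \<inter> neighbours G12 2" by blast
  then show False by (simp add: neighbours_G12)
qed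

theorem mainTheorem2:
  shows "\<exists>G :: nat pair_pre_digraph.
           pair_graph G \<and> Digraph_Component.connected (with_proj G) \<and> parcs G \<noteq> {} \<and>
           (\<forall>n. \<forall>x\<in>pverts G. \<forall>y\<in>pverts G. return_prob G x n = return_prob G y n) \<and>
           \<not> vertex_transitive G"
proof (intro exI conjI allI ballI)
  show "parcs G12 \<noteq> {}"
    using neighbours_iff[of 2 G12 0] by (auto simp: neighbours_G12)
qed (fact pair_graph_G12 connected_G12 return_prob_G12 not_vertex_transitive_G12)+

end
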